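(* Let $m,n,s$ be positive integers. Suppose that $\Phi\in\mathbb{R}^{m\times n}$ satisfies the $2s$-restricted isometry property with a constant $\delta_{2s}<\frac{1}{3}$ and let $\eta\geq 0$. Then, for any $x\in\mathbb{H}^n$ and any $y=\Phi x+e$ with $e\in\mathbb{H}^m$, $\|e\|_2\leq\eta$, every solution $x^{\#}\in\mathbb{H}^n$ of the problem $$\operatorname*{arg\,min}_{z\in\mathbb{H}^n}\|z\|_1\quad\text{subject to}\quad\|\Phi z-y\|_2\leq\eta$$ satisfies $$\|x^{\#}-x\|_2\leq\frac{C_0}{\sqrt{s}}\,\|x-x|_s\|_1+C_1\eta$$ with constants $$C_0=\frac{2(1+\delta_{2s})}{1-3\delta_{2s}},\qquad C_1=\frac{4\sqrt{1+\delta_{2s}}}{1-3\delta_{2s}},$$ where $x|_s$ denotes the best $s$-sparse approximation of $x$.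
   Context: $\mathbb{H}$ denotes the algebra of quaternions $q=a+b\mathbf{i}+c\mathbf{j}+d\mathbf{k}$, $a,b,c,d\in\mathbb{R}$, with norm $|q|=\sqrt{a^2+b^2+c^2+d^2}$. For $x=(x_1,\ldots,x_n)^T\in\mathbb{H}^n$ and $p\in[1,\infty)$, $\|x\|_p=\left(\sum_{i=1}^n|x_i|^p\right)^{1/p}$. A real matrix $\Phi\in\mathbb{R}^{m\times n}$ acts on $\mathbb{H}^n$ by the usual matrix-vector product, with real numbers regarded as quaternions. A vector (real or quaternion) is called $s$-sparse if it has at most $s$ nonzero coordinates. Restricted isometry property: for a positive integer $r$, $\Phi\in\mathbb{R}^{m\times n}$ satisfies the $r$-restricted isometry property (for real vectors) with a constant $\delta_r\geq0$ if $(1-\delta_r)\|v\|_2^2\leq\|\Phi v\|_2^2\leq(1+\delta_r)\|v\|_2^2$ for all $r$-sparse real vectors $v\in\mathbb{R}^n$. Best $s$-sparse approximation: $x|_s$ is the vector that agrees with $x$ on the set $T_0$ of indices of the $s$ coordinates of $x$ with the biggest quaternion norms $|x_i|$ (ties broken arbitrarily; all indices if $s\ge n$) and is zero at all other indices. *)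

theory Defs
  imports "HOL-Analysis.Analysis"
begin

section \<open>Quaternions\<close>

datatype quat = Quat (qRe: real) (qI: real) (qJ: real) (qK: real)

lemma quat_eq_iff:
  "x = y \<longleftrightarrow> qRe x = qRe y \<and> qI x = qI y \<and> qJ x = qJ y \<and> qK x = qK y"
  by (cases x; cases y) simp

instantiation quat :: "{ring_1, real_algebra_1}"
begin

definition "0 = Quat 0 0 0 0"
definition "1 = Quat 1 0 0 0"
definition "x + y = Quat (qRe x + qRe y) (qI x + qI y) (qJ x + qJ y) (qK x + qK y)"
definition "- x = Quat (- qRe x) (- qI x) (- qJ x) (- qK x)"
definition "x - y = Quat (qRe x - qRe y) (qI x - qI y) (qJ x - qJ y) (qK x - qK y)"
definition "x * y = Quat
  (qRe x * qRe y - qI x * qI y - qJ x * qJ y - qK x * qK y)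
  (qRe x * qI y + qI x * qRe y + qJ x * qK y - qK x * qJ y)
  (qRe x * qJ y - qI x * qK y + qJ x * qRe y + qK x * qI y)
  (qRe x * qK y + qI x * qJ y - qJ x * qI y + qK x * qRe y)"
definition "r *\<^sub>R x = Quat (r * qRe x) (r * qI x) (r * qJ x) (r * qK x)"

instance
  by standard
     (simp_all add: quat_eq_iff zero_quat_def one_quat_def plus_quat_def uminus_quat_def
       minus_quat_def times_quat_def scaleR_quat_def algebra_simps)

end

lemma quat_sel_simps [simp]:
  "qRe 0 = 0" "qI 0 = 0" "qJ 0 = 0" "qK 0 = 0"
  "qRe 1 = 1" "qI 1 = 0" "qJ 1 = 0" "qK 1 = 0"
  "qRe (x + y) = qRe x + qRe y" "qI (x + y) = qI x + qI y"
  "qJ (x + y) = qJ x + qJ y" "qK (x + y) = qK x + qK y"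
  "qRe (- x) = - qRe x" "qI (- x) = - qI x" "qJ (- x) = - qJ x" "qK (- x) = - qK x"
  "qRe (x - y) = qRe x - qRe y" "qI (x - y) = qI x - qI y"
  "qJ (x - y) = qJ x - qJ y" "qK (x - y) = qK x - qK y"
  "qRe (x * y) = qRe x * qRe y - qI x * qI y - qJ x * qJ y - qK x * qK y"
  "qI (x * y) = qRe x * qI y + qI x * qRe y + qJ x * qK y - qK x * qJ y"
  "qJ (x * y) = qRe x * qJ y - qI x * qK y + qJ x * qRe y + qK x * qI y"
  "qK (x * y) = qRe x * qK y + qI x * qJ y - qJ x * qI y + qK x * qRe y"
  "qRe (r *\<^sub>R x) = r * qRe x" "qI (r *\<^sub>R x) = r * qI x"
  "qJ (r *\<^sub>R x) = r * qJ x" "qK (r *\<^sub>R x) = r * qK x"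
  by (simp_all add: zero_quat_def one_quat_def plus_quat_def uminus_quat_def
       minus_quat_def times_quat_def scaleR_quat_def)

instantiation quat :: real_inner
begin

definition inner_quat :: "quat \<Rightarrow> quat \<Rightarrow> real" where
  "inner_quat x y = qRe x * qRe y + qI x * qI y + qJ x * qJ y + qK x * qK y"
definition norm_quat :: "quat \<Rightarrow> real" where
  "norm_quat x = sqrt ((qRe x)\<^sup>2 + (qI x)\<^sup>2 + (qJ x)\<^sup>2 + (qK x)\<^sup>2)"
definition sgn_quat :: "quat \<Rightarrow> quat" where
  "sgn_quat x = x /\<^sub>R norm x"
definition dist_quat :: "quat \<Rightarrow> quat \<Rightarrow> real" where
  "dist_quat x y = norm (x - y)"
definition uniformity_quat :: "(quat \<times> quat) filter" where
  "uniformity_quat = (INF e\<in>{0<..}. principal {(x, y). dist x y < e})"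
definition open_quat :: "quat set \<Rightarrow> bool" where
  "open_quat U \<longleftrightarrow> (\<forall>x\<in>U. eventually (\<lambda>(x', y). x' = x \<longrightarrow> y \<in> U) uniformity)"

instance
proof
  fix x y z :: quat and r :: real and U :: "quat set"
  show "dist x y = norm (x - y)" by (fact dist_quat_def)
  show "sgn x = x /\<^sub>R norm x" by (fact sgn_quat_def)
  show "(uniformity :: (quat \<times> quat) filter) = (INF e\<in>{0<..}. principal {(x, y). dist x y < e})"
    by (fact uniformity_quat_def)
  show "open U \<longleftrightarrow> (\<forall>x\<in>U. eventually (\<lambda>(x', y). x' = x \<longrightarrow> y \<in> U) uniformity)"
    by (fact open_quat_def)
  show "inner x y = inner y x" by (simp add: inner_quat_def mult.commute)
  show "inner (x + y) z = inner x z + inner y z" by (simp add: inner_quat_def algebra_simps)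
  show "inner (r *\<^sub>R x) y = r * inner x y" by (simp add: inner_quat_def algebra_simps)
  show "0 \<le> inner x x" by (simp add: inner_quat_def)
  have "a * a + b * b + c * c + d * d = 0 \<longleftrightarrow> a = 0 \<and> b = 0 \<and> c = 0 \<and> d = 0"
    for a b c d :: real
    by (smt (verit, best) mult_eq_0_iff zero_le_square)
  then show "inner x x = 0 \<longleftrightarrow> x = 0" by (simp add: inner_quat_def quat_eq_iff)
  show "norm x = sqrt (inner x x)"
    by (simp add: norm_quat_def inner_quat_def power2_eq_square)
qed

end

instantiation quat :: real_normed_div_algebra
begin

definition inverse_quat :: "quat \<Rightarrow> quat" where
  "inverse_quat x = Quat (qRe x) (- qI x) (- qJ x) (- qK x) /\<^sub>R (norm x)\<^sup>2"
definition divide_quat :: "quat \<Rightarrow> quat \<Rightarrow> quat" where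
  "divide_quat x y = x * inverse y" for x y :: quat

instance
proof
  fix x y :: quat
  have n: "(norm z)\<^sup>2 = (qRe z)\<^sup>2 + (qI z)\<^sup>2 + (qJ z)\<^sup>2 + (qK z)\<^sup>2" for z :: quat
    by (simp add: norm_quat_def)
  define c where "c = Quat (qRe x) (- qI x) (- qJ x) (- qK x)"
  have i: "inverse x = c /\<^sub>R (norm x)\<^sup>2" by (simp add: inverse_quat_def c_def)
  have c: "c * x = (norm x)\<^sup>2 *\<^sub>R 1" "x * c = (norm x)\<^sup>2 *\<^sub>R 1"
    unfolding n by (simp_all add: quat_eq_iff c_def power2_eq_square)
  show "inverse x * x = 1" if "x \<noteq> 0" using that by (simp add: i c)
  show "x * inverse x = 1" if "x \<noteq> 0" using that by (simp add: i c)
  show "x div y = x * inverse y" by (fact divide_quat_def)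
  show "inverse 0 = (0::quat)" by (simp add: inverse_quat_def)
  have "(norm (x * y))\<^sup>2 = (norm x * norm y)\<^sup>2"
    unfolding power_mult_distrib n by (simp add: power2_eq_square algebra_simps)
  then show "norm (x * y) = norm x * norm y"
    by (simp add: power2_eq_iff_nonneg)
qed

end

lemma quat_units:
  defines "i \<equiv> Quat 0 1 0 0" and "j \<equiv> Quat 0 0 1 0" and "k \<equiv> Quat 0 0 0 1"
  shows "Quat a b c d = of_real a + of_real b * i + of_real c * j + of_real d * k"
    and "i * i = -1" and "j * j = -1" and "k * k = -1" and "i * j * k = -1"
    and "i * j = k" and "j * k = i" and "k * i = j"
  by (simp_all add: quat_eq_iff i_def j_def k_def of_real_def)


section \<open>Sparse recovery\<close>

definition lp_norm :: "real \<Rightarrow> 'a::real_normed_vector ^ 'n \<Rightarrow> real" where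
  "lp_norm p x = (\<Sum>i\<in>UNIV. norm (x $ i) powr p) powr (1 / p)"

lemma lp_norm_1: "lp_norm 1 x = (\<Sum>i\<in>UNIV. norm (x $ i))"
  by (simp add: lp_norm_def sum_nonneg)

lemma lp_norm_2: "lp_norm 2 x = norm x"
  by (simp add: lp_norm_def norm_vec_def L2_set_def powr_half_sqrt sum_nonneg)

definition sparse :: "nat \<Rightarrow> 'a::zero ^ 'n \<Rightarrow> bool" where
  "sparse s x \<longleftrightarrow> card {i. x $ i \<noteq> 0} \<le> s"

definition rip :: "nat \<Rightarrow> real \<Rightarrow> real ^ 'n ^ 'm \<Rightarrow> bool" where
  "rip r \<delta> \<Phi> \<longleftrightarrow> 0 \<le> \<delta> \<and>
     (\<forall>v :: real ^ 'n. sparse r v \<longrightarrow>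
        (1 - \<delta>) * (lp_norm 2 v)\<^sup>2 \<le> (lp_norm 2 (\<Phi> *v v))\<^sup>2 \<and>
        (lp_norm 2 (\<Phi> *v v))\<^sup>2 \<le> (1 + \<delta>) * (lp_norm 2 v)\<^sup>2)"

definition qmult_vec :: "real ^ 'n ^ 'm \<Rightarrow> quat ^ 'n \<Rightarrow> quat ^ 'm" where
  "qmult_vec \<Phi> x = map_matrix of_real \<Phi> *v x"

text \<open>A relation rather than a function, since ties between coordinates of equal norm may be
  broken in any way; the set \<open>T\<close> consists of \<open>s\<close> indices of largest coordinates, or of all
  indices if there are at most \<open>s\<close>.\<close>

definition best_sparse_approx :: "nat \<Rightarrow> 'a::real_normed_vector ^ 'n \<Rightarrow> 'a ^ 'n \<Rightarrow> bool" where
  "best_sparse_approx s x xs \<longleftrightarrow>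
     (\<exists>T. card T = min s CARD('n) \<and>
          (\<forall>i\<in>T. \<forall>j\<in>- T. norm (x $ j) \<le> norm (x $ i)) \<and>
          xs = (\<chi> i. if i \<in> T then x $ i else 0))"

end

theory Submission
  imports Defs
begin

text \<open>
  A real matrix acts separately on the four real components of a quaternion vector, so the
  restricted isometry property carries over to sparse quaternion vectors with the same constant,
  and polarization makes the images of disjointly supported sparse vectors almost orthogonal with
  respect to the real inner product. The error \<open>h = x\<^sup># - x\<close> is split into \<open>h\<close> on
  \<open>T\<close>, on the \<open>s\<close> largest coordinates outside \<open>T\<close> (the set \<open>U\<close>), and on the rest
  \<open>R\<close>. Cutting \<open>R\<close> into blocks of decreasing size bounds both the norm of the part on \<open>R\<close> and
  its correlation with the part on \<open>T \<union> U\<close> by the 1-norm of \<open>h\<close> outside \<open>T\<close>, which the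
  minimality of \<open>x\<^sup>#\<close> controls by the part on \<open>T\<close>.
\<close>

section \<open>Restriction of vectors to index sets\<close>

definition restrict_vec :: "'a::zero ^ 'n \<Rightarrow> 'n set \<Rightarrow> 'a ^ 'n" where
  "restrict_vec h A = (\<chi> i. if i \<in> A then h $ i else 0)"

lemma restrict_vec_nth [simp]: "restrict_vec h A $ i = (if i \<in> A then h $ i else 0)"
  by (simp add: restrict_vec_def)

lemma restrict_vec_empty [simp]: "restrict_vec h {} = 0"
  by (simp add: vec_eq_iff)

lemma restrict_vec_UNIV [simp]: "restrict_vec h UNIV = h"
  by (simp add: vec_eq_iff)

lemma restrict_vec_Un:
  fixes h :: "'a::monoid_add ^ 'n"
  assumes "A \<inter> B = {}"
  shows "restrict_vec h (A \<union> B) = restrict_vec h A + restrict_vec h B"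
  using assms by (auto simp: vec_eq_iff)

lemma sparse_restrict_vec:
  assumes "card A \<le> k"
  shows "sparse k (restrict_vec h A)"
proof -
  have "card {i. restrict_vec h A $ i \<noteq> 0} \<le> card A"
    by (intro card_mono) auto
  then show ?thesis
    using assms by (simp add: sparse_def)
qed

lemma norm_vec_square:
  fixes h :: "'a::real_normed_vector ^ 'n"
  shows "(norm h)\<^sup>2 = (\<Sum>i\<in>UNIV. (norm (h $ i))\<^sup>2)"
  by (simp add: norm_vec_def L2_set_def sum_nonneg)

lemma norm_restrict_vec_square:
  fixes h :: "'a::real_normed_vector ^ 'n"
  shows "(norm (restrict_vec h A))\<^sup>2 = (\<Sum>i\<in>A. (norm (h $ i))\<^sup>2)"
proof -
  have "(norm (restrict_vec h A))\<^sup>2 = (\<Sum>i\<in>UNIV. if i \<in> A then (norm (h $ i))\<^sup>2 else 0)"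
    unfolding norm_vec_square by (intro sum.cong) auto
  then show ?thesis
    by (simp add: sum.If_cases)
qed

lemma norm_restrict_vec_mono:
  fixes h :: "'a::real_normed_vector ^ 'n"
  assumes "A \<subseteq> B"
  shows "norm (restrict_vec h A) \<le> norm (restrict_vec h B)"
proof (rule power2_le_imp_le)
  show "(norm (restrict_vec h A))\<^sup>2 \<le> (norm (restrict_vec h B))\<^sup>2"
    unfolding norm_restrict_vec_square using assms by (intro sum_mono2) auto
qed simp

lemma sum_norm_le_sqrt_card_mult_norm:
  fixes h :: "'a::real_normed_vector ^ 'n"
  assumes "card A \<le> s"
  shows "(\<Sum>i\<in>A. norm (h $ i)) \<le> sqrt (real s) * norm (restrict_vec h A)"
proof (rule power2_le_imp_le)
  have "(\<Sum>i\<in>A. norm (h $ i) * 1)\<^sup>2 \<le> (\<Sum>i\<in>A. (norm (h $ i))\<^sup>2) * (\<Sum>i\<in>A. 1\<^sup>2)"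
    by (rule Cauchy_Schwarz_ineq_sum)
  also have "\<dots> \<le> (norm (restrict_vec h A))\<^sup>2 * real s"
    unfolding norm_restrict_vec_square
    using assms by (intro mult_mono) (auto intro: sum_nonneg)
  finally show "(\<Sum>i\<in>A. norm (h $ i))\<^sup>2 \<le> (sqrt (real s) * norm (restrict_vec h A))\<^sup>2"
    by (simp add: power_mult_distrib mult.commute)
qed simp

section \<open>Largest coordinates and decreasing blocks\<close>

lemma obtain_largest_subset:
  fixes a :: "'i \<Rightarrow> real"
  assumes "finite B" and "k \<le> card B"
  obtains T where "T \<subseteq> B" "card T = k" "\<And>i j. i \<in> T \<Longrightarrow> j \<in> B - T \<Longrightarrow> a j \<le> a i"
proof -
  have "\<exists>T\<subseteq>B. card T = k \<and> (\<forall>i\<in>T. \<forall>j\<in>B - T. a j \<le> a i)"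
    using assms(2)
  proof (induction k)
    case 0
    show ?case by (rule exI[of _ "{}"]) simp
  next
    case (Suc k)
    then obtain T where T: "T \<subseteq> B" "card T = k" "\<forall>i\<in>T. \<forall>j\<in>B - T. a j \<le> a i"
      by auto
    have fin: "finite T"
      using T(1) assms(1) by (rule finite_subset)
    have "B - T \<noteq> {}"
      using Suc.prems T(1,2) fin assms(1) by (metis Diff_eq_empty_iff card_mono not_less_eq_eq)
    then have "Max (a ` (B - T)) \<in> a ` (B - T)"
      using assms(1) by (intro Max_in) auto
    \<comment> \<open>Adding a maximiser \<open>m\<close> of \<open>a\<close> on
      \<open>B - T\<close> preserves domination: the members of \<open>T\<close> already dominate
      everything outside, and \<open>m\<close> dominates what remains.\<close>
    then obtain m where m: "m \<in> B - T" "a m = Max (a ` (B - T))"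
      by auto
    have max: "a j \<le> a m" if "j \<in> B - T" for j
      unfolding m(2) using that assms(1) by (intro Max_ge) auto
    show ?case
      using T m(1) fin max by (intro exI[of _ "insert m T"]) auto
  qed
  then show thesis
    using that by blast
qed

text \<open>The block argument, stated for a subadditive set function \<open>F\<close> because it is needed both
  for the norm and for a correlation.\<close>

lemma subadditive_block_bound:
  fixes h :: "'a::real_normed_vector ^ 'n" and F :: "'n set \<Rightarrow> real"
  assumes "s \<ge> 1" and "c \<ge> 0"
    and sub: "\<And>A B. A \<union> B \<subseteq> W \<Longrightarrow> A \<inter> B = {} \<Longrightarrow> F (A \<union> B) \<le> F A + F B"
    and small: "\<And>A. A \<subseteq> W \<Longrightarrow> card A \<le> s \<Longrightarrow> F A \<le> c * norm (restrict_vec h A)"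
    and "B \<subseteq> W" and "card T = s"
    and "\<And>i j. i \<in> T \<Longrightarrow> j \<in> B \<Longrightarrow> norm (h $ j) \<le> norm (h $ i)"
  shows "F B \<le> c / sqrt (real s) * ((\<Sum>i\<in>T. norm (h $ i)) + (\<Sum>i\<in>B. norm (h $ i)))"
  using assms(5-7)
proof (induction "card B" arbitrary: B T rule: less_induct)
  case less
  have block: "F A \<le> c / sqrt (real s) * (\<Sum>i\<in>T. norm (h $ i))"
    if A: "A \<subseteq> B" "card A \<le> s" for A
  proof -
    define S where "S = (\<Sum>i\<in>T. norm (h $ i))"
    \<comment> \<open>Every coordinate in \<open>T\<close> dominates those in \<open>A\<close>,
      hence so does their mean \<open>S / s\<close>. At most \<open>s\<close> such coordinates then
      have Euclidean norm at most \<open>S / sqrt s\<close>.\<close>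
    have bd: "norm (h $ j) \<le> S / real s" if "j \<in> A" for j
    proof -
      have "real (card T) * norm (h $ j) \<le> S"
        unfolding S_def using less.prems(3) A that by (intro sum_bounded_below) auto
      then show ?thesis
        using assms(1) less.prems(2) by (simp add: pos_le_divide_eq mult.commute)
    qed
    have "S \<ge> 0"
      by (simp add: S_def sum_nonneg)
    have "(norm (restrict_vec h A))\<^sup>2 \<le> real (card A) * (S / real s)\<^sup>2"
      unfolding norm_restrict_vec_square using bd by (intro sum_bounded_above power_mono) auto
    also have "\<dots> \<le> real s * (S / real s)\<^sup>2"
      using A(2) by (intro mult_right_mono) auto
    also have "\<dots> = (S / sqrt (real s))\<^sup>2"
      using assms(1) by (simp add: power_divide power2_eq_square)
    finally have "norm (restrict_vec h A) \<le> S / sqrt (real s)"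
      by (rule power2_le_imp_le) (use \<open>S \<ge> 0\<close> in simp)
    then have "c * norm (restrict_vec h A) \<le> c * (S / sqrt (real s))"
      using assms(2) by (rule mult_left_mono)
    moreover have "F A \<le> c * norm (restrict_vec h A)"
      using A less.prems(1) by (intro small) auto
    ultimately show ?thesis
      by (simp add: S_def)
  qed
  show ?case
  proof (cases "card B \<le> s")
    case True
    have "0 \<le> c / sqrt (real s) * (\<Sum>i\<in>B. norm (h $ i))"
      using assms(2) by (intro mult_nonneg_nonneg divide_nonneg_nonneg sum_nonneg) auto
    then show ?thesis
      using block[OF order.refl True] by (simp add: distrib_left)
  next
    case False
    then obtain V where V: "V \<subseteq> B" "card V = s"
      "\<And>i j. i \<in> V \<Longrightarrow> j \<in> B - V \<Longrightarrow> norm (h $ j) \<le> norm (h $ i)"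
      using obtain_largest_subset[of B s "\<lambda>i. norm (h $ i)"] by auto
    have "V \<noteq> {}"
      using V(2) assms(1) by auto
    then have "card (B - V) < card B"
      using V(1) by (intro psubset_card_mono) auto
    \<comment> \<open>\<open>V\<close> takes the role of \<open>T\<close> for the remainder, so the
      two sums produced here join to the full sum over \<open>B\<close>, while the block
      \<open>V\<close> itself is paid for by the sum over \<open>T\<close>.\<close>
    then have rest: "F (B - V) \<le> c / sqrt (real s) *
        ((\<Sum>i\<in>V. norm (h $ i)) + (\<Sum>i\<in>B - V. norm (h $ i)))"
      using V less.prems(1) by (intro less.hyps) auto
    have B: "V \<union> (B - V) = B"
      using V(1) by auto
    have "F B \<le> F V + F (B - V)"
      using sub[of V "B - V"] less.prems(1) unfolding B by auto
    also have "\<dots> \<le> c / sqrt (real s) * (\<Sum>i\<in>T. norm (h $ i)) + c / sqrt (real s) *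
        ((\<Sum>i\<in>V. norm (h $ i)) + (\<Sum>i\<in>B - V. norm (h $ i)))"
      using block[of V] V rest by (intro add_mono) auto
    also have "(\<Sum>i\<in>V. norm (h $ i)) + (\<Sum>i\<in>B - V. norm (h $ i)) = (\<Sum>i\<in>B. norm (h $ i))"
      using sum.subset_diff[OF V(1), of "\<lambda>i. norm (h $ i)"] by simp
    finally show ?thesis
      by (simp add: distrib_left)
  qed
qed

section \<open>Error bound for an abstract restricted isometry\<close>

text \<open>Polarization is applied to the unit vectors \<open>p\<close> and \<open>q\<close>. Being
  orthogonal, they give \<open>p + q\<close> and \<open>p - q\<close> squared norm 2, so four times
  the inner product of the images is at most 2(1 + \<delta>) - 2(1 - \<delta>) = 4\<delta> in
  absolute value. Normalizing first is what yields the product of the norms after scaling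
  back.\<close>

lemma rip_disjoint_inner_le:
  fixes L :: "'a::real_inner ^ 'n \<Rightarrow> 'b::real_inner" and u v :: "'a ^ 'n"
  assumes "linear L"
    and rip: "\<And>w. sparse k w \<Longrightarrow>
      (1 - \<delta>) * (norm w)\<^sup>2 \<le> (norm (L w))\<^sup>2 \<and> (norm (L w))\<^sup>2 \<le> (1 + \<delta>) * (norm w)\<^sup>2"
    and "A \<inter> B = {}" and "card (A \<union> B) \<le> k"
    and u: "\<And>i. i \<notin> A \<Longrightarrow> u $ i = 0" and v: "\<And>i. i \<notin> B \<Longrightarrow> v $ i = 0"
  shows "\<bar>L u \<bullet> L v\<bar> \<le> \<delta> * norm u * norm v"
proof (cases "u = 0 \<or> v = 0")
  case True
  then show ?thesis
    using linear_0[OF assms(1)] by auto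
next
  case False
  define p where "p = u /\<^sub>R norm u"
  define q where "q = v /\<^sub>R norm v"
  have pq: "norm p = 1" "norm q = 1"
    using False by (simp_all add: p_def q_def)
  have "u \<bullet> v = 0"
    unfolding inner_vec_def using u v assms(3)
    by (intro sum.neutral) (metis IntI empty_iff inner_zero_left inner_zero_right)
  then have orth: "p \<bullet> q = 0"
    by (simp add: p_def q_def)
  have supp: "i \<in> A \<union> B" if "p $ i \<noteq> 0 \<or> q $ i \<noteq> 0" for i
    using that u v by (auto simp: p_def q_def)
  have "card {i. (p + q) $ i \<noteq> 0} \<le> card (A \<union> B)" "card {i. (p - q) $ i \<noteq> 0} \<le> card (A \<union> B)"
    using supp by (intro card_mono; force)+
  then have sp: "sparse k (p + q)" "sparse k (p - q)"
    using assms(4) by (simp_all add: sparse_def)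
  have n: "(norm (p + q))\<^sup>2 = 2" "(norm (p - q))\<^sup>2 = 2"
    using pq orth by (simp_all add: power2_norm_eq_inner inner_add inner_diff inner_commute norm_eq_1)
  have polar: "4 * (L p \<bullet> L q) = (norm (L (p + q)))\<^sup>2 - (norm (L (p - q)))\<^sup>2"
    by (simp add: power2_norm_eq_inner linear_add[OF assms(1)] linear_diff[OF assms(1)]
      inner_add inner_diff inner_commute)
  have "\<bar>L p \<bullet> L q\<bar> \<le> \<delta>"
    using rip[OF sp(1)] rip[OF sp(2)] polar unfolding n by (auto simp: abs_le_iff)
  then have "\<bar>L p \<bullet> L q\<bar> * (norm u * norm v) \<le> \<delta> * (norm u * norm v)"
    by (intro mult_right_mono) auto
  moreover have "L u \<bullet> L v = (L p \<bullet> L q) * (norm u * norm v)"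
    using False by (simp add: p_def q_def linear_scale[OF assms(1)] field_simps)
  ultimately show ?thesis
    by (simp add: abs_mult mult.assoc)
qed

text \<open>The optimization problem enters only through \<open>cone\<close> (minimality) and
  \<open>tube\<close> (feasibility), and the quaternions only through the isometry bounds for
  \<open>L\<close>.\<close>

theorem rip_error_bound:
  fixes L :: "'a::real_inner ^ 'n \<Rightarrow> 'b::real_inner" and h :: "'a ^ 'n"
  assumes "s \<ge> 1" and "linear L" and "0 \<le> \<delta>" and "\<delta> < 1 / 3"
    and rip: "\<And>w. sparse (2 * s) w \<Longrightarrow>
      (1 - \<delta>) * (norm w)\<^sup>2 \<le> (norm (L w))\<^sup>2 \<and> (norm (L w))\<^sup>2 \<le> (1 + \<delta>) * (norm w)\<^sup>2"
    and "card T \<le> s"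
    and cone: "(\<Sum>i\<in>-T. norm (h $ i)) \<le> (\<Sum>i\<in>T. norm (h $ i)) + 2 * \<sigma>"
    and tube: "norm (L h) \<le> 2 * \<eta>"
  shows "norm h \<le> (2 * (1 + \<delta>) / (1 - 3 * \<delta>)) / sqrt (real s) * \<sigma>
      + (4 * sqrt (1 + \<delta>) / (1 - 3 * \<delta>)) * \<eta>"
proof -
  \<comment> \<open>Fewer than \<open>s\<close> indices may lie outside \<open>T\<close>, hence the
    minimum; in that case \<open>U\<close> exhausts the complement and \<open>R\<close> is
    empty.\<close>
  obtain U where U: "U \<subseteq> - T" "card U = min s (card (- T))"
    "\<And>i j. i \<in> U \<Longrightarrow> j \<in> - T - U \<Longrightarrow> norm (h $ j) \<le> norm (h $ i)"
    using obtain_largest_subset[of "- T" "min s (card (- T))" "\<lambda>i. norm (h $ i)"] by auto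
  define R where "R = - T - U"
  define E where "E = (\<Sum>i\<in>-T. norm (h $ i)) / sqrt (real s)"
  let ?r = "restrict_vec h"
  have "E \<ge> 0"
    unfolding E_def by (intro divide_nonneg_nonneg sum_nonneg) auto
  have disj: "T \<inter> U = {}" "(T \<union> U) \<inter> R = {}" "(T \<union> U) \<union> R = UNIV"
    using U(1) by (auto simp: R_def)
  have cardU: "card U \<le> s"
    using U(2) by simp
  \<comment> \<open>The block bound with \<open>U\<close> as leading block, so that the sums over
    \<open>U\<close> and \<open>R\<close> make up the sum over \<open>-T\<close>. The condition on
    \<open>F {}\<close> covers the case of empty \<open>R\<close>.\<close>
  have tail: "F R \<le> c * E"
    if "c \<ge> 0" "F {} \<le> 0" and sub: "\<And>A B. A \<union> B \<subseteq> R \<Longrightarrow> A \<inter> B = {} \<Longrightarrow> F (A \<union> B) \<le> F A + F B"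
      and small: "\<And>A. A \<subseteq> R \<Longrightarrow> card A \<le> s \<Longrightarrow> F A \<le> c * norm (?r A)" for F c
  proof (cases "card U = s")
    case True
    have "F R \<le> c / sqrt (real s) * ((\<Sum>i\<in>U. norm (h $ i)) + (\<Sum>i\<in>R. norm (h $ i)))"
      using assms(1) that(1) sub small order.refl True
      by (rule subadditive_block_bound) (use U(3) in \<open>auto simp: R_def\<close>)
    also have "(\<Sum>i\<in>U. norm (h $ i)) + (\<Sum>i\<in>R. norm (h $ i)) = (\<Sum>i\<in>-T. norm (h $ i))"
      using sum.subset_diff[OF U(1), of "\<lambda>i. norm (h $ i)"] by (simp add: R_def)
    finally show ?thesis
      by (simp add: E_def)
  next
    case False
    then have "U = - T"
      using U(1,2) by (intro card_subset_eq) auto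
    then show ?thesis
      using that(2) mult_nonneg_nonneg[OF that(1) \<open>E \<ge> 0\<close>] by (simp add: R_def)
  qed
  \<comment> \<open>Isometry of order \<open>2 * s\<close> allows only \<open>s\<close> indices in
    \<open>V\<close> next to a block of size \<open>s\<close>. This bound is therefore applied to
    \<open>T\<close> and \<open>U\<close> separately, which produces the factor 2 in front of
    \<delta> below.\<close>
  have corr: "\<bar>L (?r V) \<bullet> L (?r R)\<bar> \<le> \<delta> * norm (?r V) * E" if V: "card V \<le> s" "V \<inter> R = {}" for V
  proof (rule tail[where F = "\<lambda>A. \<bar>L (?r V) \<bullet> L (?r A)\<bar>"])
    fix A B :: "'n set" assume "A \<inter> B = {}"
    then show "\<bar>L (?r V) \<bullet> L (?r (A \<union> B))\<bar> \<le> \<bar>L (?r V) \<bullet> L (?r A)\<bar> + \<bar>L (?r V) \<bullet> L (?r B)\<bar>"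
      by (simp add: restrict_vec_Un linear_add[OF assms(2)] inner_add_right)
  next
    fix A assume A: "A \<subseteq> R" "card A \<le> s"
    have "card (V \<union> A) \<le> 2 * s"
      using card_Un_le[of V A] A(2) V(1) by simp
    then show "\<bar>L (?r V) \<bullet> L (?r A)\<bar> \<le> \<delta> * norm (?r V) * norm (?r A)"
      using A V by (intro rip_disjoint_inner_le[OF assms(2) rip, where A = V and B = A]) auto
  qed (use assms(3) linear_0[OF assms(2)] in auto)
  have tailnorm: "norm (?r R) \<le> 1 * E"
    by (rule tail[where F = "\<lambda>A. norm (?r A)"]) (auto simp: restrict_vec_Un norm_triangle_ineq)
  define N where "N = norm (?r (T \<union> U))"
  have NT: "norm (?r T) \<le> N" and NU: "norm (?r U) \<le> N" and "N \<ge> 0"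
    by (auto simp: N_def intro: norm_restrict_vec_mono)
  have "card (T \<union> U) \<le> 2 * s"
    using card_Un_le[of T U] cardU assms(6) by simp
  note ripTU = rip[OF sparse_restrict_vec[OF this, of h], folded N_def]
  have h: "h = ?r (T \<union> U) + ?r R"
    using restrict_vec_Un[OF disj(2), of h] by (simp add: disj(3))
  have Lh: "L h = L (?r (T \<union> U)) + L (?r R)"
    by (subst h) (rule linear_add[OF assms(2)])
  have "norm (L (?r (T \<union> U))) \<le> sqrt (1 + \<delta>) * N"
    by (rule power2_le_imp_le)
      (use conjunct2[OF ripTU] assms(3) \<open>N \<ge> 0\<close> in \<open>simp_all add: power_mult_distrib\<close>)
  then have "norm (L (?r (T \<union> U))) * norm (L h) \<le> (sqrt (1 + \<delta>) * N) * (2 * \<eta>)"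
    using tube assms(3) \<open>N \<ge> 0\<close> by (intro mult_mono) auto
  then have main: "L (?r (T \<union> U)) \<bullet> L h \<le> (sqrt (1 + \<delta>) * N) * (2 * \<eta>)"
    using norm_cauchy_schwarz[of "L (?r (T \<union> U))" "L h"] by simp
  have "\<delta> * norm (?r V) * E \<le> \<delta> * N * E" if "norm (?r V) \<le> N" for V
    using that assms(3) \<open>E \<ge> 0\<close> by (intro mult_right_mono mult_left_mono) auto
  moreover have "T \<inter> R = {}" "U \<inter> R = {}"
    using disj(2) by auto
  ultimately have "\<bar>L (?r T) \<bullet> L (?r R)\<bar> \<le> \<delta> * N * E" "\<bar>L (?r U) \<bullet> L (?r R)\<bar> \<le> \<delta> * N * E"
    using order_trans[OF corr] NT NU assms(6) cardU by simp_all
  moreover have "L (?r (T \<union> U)) = L (?r T) + L (?r U)"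
    by (simp add: restrict_vec_Un[OF disj(1)] linear_add[OF assms(2)])
  ultimately have "- (L (?r (T \<union> U)) \<bullet> L (?r R)) \<le> 2 * (\<delta> * N * E)"
    by (simp add: inner_add_left)
  \<comment> \<open>The image of the head is the image of \<open>h\<close> minus that of the tail:
    \<open>tube\<close> controls the first term, the correlation bounds the second.\<close>
  moreover have "(norm (L (?r (T \<union> U))))\<^sup>2 = L (?r (T \<union> U)) \<bullet> L h - L (?r (T \<union> U)) \<bullet> L (?r R)"
    by (simp add: Lh inner_add_right power2_norm_eq_inner)
  ultimately have "(1 - \<delta>) * N\<^sup>2 \<le> (sqrt (1 + \<delta>) * N) * (2 * \<eta>) + 2 * (\<delta> * N * E)"
    using main ripTU by linarith
  then have "N * ((1 - \<delta>) * N) \<le> N * (2 * sqrt (1 + \<delta>) * \<eta> + 2 * \<delta> * E)"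
    by (simp add: power2_eq_square algebra_simps)
  \<comment> \<open>Cancelling \<open>N\<close> requires \<open>N > 0\<close>; for
    \<open>N = 0\<close> the claim is just this nonnegativity.\<close>
  moreover have "0 \<le> 2 * sqrt (1 + \<delta>) * \<eta> + 2 * \<delta> * E"
    using assms(3) \<open>E \<ge> 0\<close> order_trans[OF norm_ge_zero tube] by simp
  ultimately have N1: "(1 - \<delta>) * N \<le> 2 * sqrt (1 + \<delta>) * \<eta> + 2 * \<delta> * E"
    using \<open>N \<ge> 0\<close> by (cases "N = 0") auto
  define e0 where "e0 = \<sigma> / sqrt (real s)"
  have sqs: "sqrt (real s) > 0"
    using assms(1) by simp
  \<comment> \<open>Cauchy-Schwarz on the at most \<open>s\<close> indices of \<open>T\<close> lets
    \<open>cone\<close>, divided by \<open>sqrt s\<close>, bound \<open>E\<close> in terms of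
    \<open>N\<close>.\<close>
  have "(\<Sum>i\<in>T. norm (h $ i)) \<le> sqrt (real s) * N"
    using sum_norm_le_sqrt_card_mult_norm[OF assms(6), of h] mult_left_mono[OF NT, of "sqrt (real s)"]
    by simp
  then have "(\<Sum>i\<in>-T. norm (h $ i)) \<le> (N + 2 * e0) * sqrt (real s)"
    using cone sqs by (simp add: e0_def algebra_simps)
  then have E: "E \<le> N + 2 * e0"
    unfolding E_def using sqs by (simp add: pos_divide_le_eq)
  have "norm h \<le> N + E"
    using norm_triangle_ineq[of "?r (T \<union> U)" "?r R"] tailnorm
    unfolding h[symmetric] N_def by simp
  then have "norm h \<le> 2 * N + 2 * e0"
    using E by simp
  then have "(1 - 3 * \<delta>) * norm h \<le> (1 - 3 * \<delta>) * (2 * N + 2 * e0)"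
    using assms(4) by (intro mult_left_mono) auto
  moreover have "2 * \<delta> * E \<le> 2 * \<delta> * (N + 2 * e0)"
    using E assms(3) by (intro mult_left_mono) auto
  \<comment> \<open>Inserting the bound on \<open>E\<close> into \<open>N1\<close> moves 2\<delta>N
    to the left, whence 1 - 3\<delta>. The coefficient of \<open>e0\<close> is 8\<delta> + 2(1 -
    3\<delta>) = 2(1 + \<delta>).\<close>
  ultimately have "(1 - 3 * \<delta>) * norm h \<le> 2 * (1 + \<delta>) * e0 + 4 * sqrt (1 + \<delta>) * \<eta>"
    using N1 by (simp add: algebra_simps)
  then have "norm h \<le> (2 * (1 + \<delta>) * e0 + 4 * sqrt (1 + \<delta>) * \<eta>) / (1 - 3 * \<delta>)"
    using assms(4) by (simp add: pos_le_divide_eq mult.commute)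
  also have "\<dots> = (2 * (1 + \<delta>) / (1 - 3 * \<delta>)) / sqrt (real s) * \<sigma>
      + (4 * sqrt (1 + \<delta>) / (1 - 3 * \<delta>)) * \<eta>"
    by (simp add: e0_def add_divide_distrib distrib_left distrib_right mult.commute)
  finally show ?thesis .
qed

section \<open>Real matrices acting on quaternion vectors\<close>

lemma qmult_vec_nth: "qmult_vec \<Phi> x $ i = (\<Sum>j\<in>UNIV. \<Phi> $ i $ j *\<^sub>R x $ j)"
  by (simp add: qmult_vec_def matrix_vector_mult_def map_matrix_def scaleR_conv_of_real)

lemma linear_qmult_vec: "linear (qmult_vec \<Phi>)"
  by (rule linearI)
    (simp_all add: vec_eq_iff qmult_vec_nth scaleR_add_right sum.distrib scaleR_sum_right mult.commute)

text \<open>The entries of the matrix are real scalars, so they pass through any real linear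
  functional; this reduces the quaternion action to real actions on components.\<close>

lemma map_qmult_vec:
  assumes "linear f"
  shows "(\<chi> i. f (qmult_vec \<Phi> x $ i)) = \<Phi> *v (\<chi> j. f (x $ j))"
  by (simp add: vec_eq_iff qmult_vec_nth matrix_vector_mult_def linear_sum[OF assms]
    linear_scale[OF assms])

lemma norm_quat_vec_square:
  "(norm x)\<^sup>2 = (norm (\<chi> i. qRe (x $ i)))\<^sup>2 + (norm (\<chi> i. qI (x $ i)))\<^sup>2
    + (norm (\<chi> i. qJ (x $ i)))\<^sup>2 + (norm (\<chi> i. qK (x $ i)))\<^sup>2"
  by (simp add: norm_vec_square norm_quat_def sum.distrib)

lemma linear_quat_components: "linear qRe" "linear qI" "linear qJ" "linear qK"
  by (rule linearI; simp)+

lemma sparse_map_vec: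
  assumes "sparse k x" and "f 0 = 0"
  shows "sparse k (\<chi> i. f (x $ i))"
proof -
  have "card {i. (\<chi> i. f (x $ i)) $ i \<noteq> 0} \<le> card {i. x $ i \<noteq> 0}"
    using assms(2) by (intro card_mono) auto
  then show ?thesis
    using assms(1) by (simp add: sparse_def)
qed

text \<open>Each real component of a sparse quaternion vector is sparse, and squared norms add up
  over the four components. Summing the real inequalities thus keeps the constant \<delta>.\<close>

lemma rip_qmult_vec:
  assumes "rip k \<delta> \<Phi>" and "sparse k x"
  shows "(1 - \<delta>) * (norm x)\<^sup>2 \<le> (norm (qmult_vec \<Phi> x))\<^sup>2 \<and>
    (norm (qmult_vec \<Phi> x))\<^sup>2 \<le> (1 + \<delta>) * (norm x)\<^sup>2"
proof -
  have c: "(1 - \<delta>) * (norm (\<chi> i. f (x $ i)))\<^sup>2 \<le> (norm (\<chi> i. f (qmult_vec \<Phi> x $ i)))\<^sup>2"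
    "(norm (\<chi> i. f (qmult_vec \<Phi> x $ i)))\<^sup>2 \<le> (1 + \<delta>) * (norm (\<chi> i. f (x $ i)))\<^sup>2"
    if "linear f" for f :: "quat \<Rightarrow> real"
    using assms(1) sparse_map_vec[OF assms(2), of f] linear_0[OF that]
    unfolding map_qmult_vec[OF that] rip_def lp_norm_2 by auto
  show ?thesis
    unfolding norm_quat_vec_square[of x] norm_quat_vec_square[of "qmult_vec \<Phi> x"] distrib_left
    by (intro conjI add_mono c linear_quat_components)
qed

section \<open>Minimality of the 1-norm and the recovery theorem\<close>

text \<open>By the triangle inequality each |z_i| is at least |x_i| - |z_i - x_i|, used on
  \<open>T\<close>, and at least |z_i - x_i| - |x_i|, used outside. After summation the part of
  \<open>x\<close> on \<open>T\<close> cancels and the part outside remains twice.\<close>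

lemma l1_minimizer_cone:
  fixes x z :: "'a::real_normed_vector ^ 'n"
  assumes "(\<Sum>i\<in>UNIV. norm (z $ i)) \<le> (\<Sum>i\<in>UNIV. norm (x $ i))"
  shows "(\<Sum>i\<in>-T. norm ((z - x) $ i))
    \<le> (\<Sum>i\<in>T. norm ((z - x) $ i)) + 2 * (\<Sum>i\<in>-T. norm (x $ i))"
proof -
  have split: "(\<Sum>i\<in>UNIV. norm (w $ i)) = (\<Sum>i\<in>T. norm (w $ i)) + (\<Sum>i\<in>-T. norm (w $ i))"
    for w :: "'a ^ 'n"
    using sum.subset_diff[of T UNIV "\<lambda>i. norm (w $ i)"] by (simp add: Compl_eq_Diff_UNIV)
  have "(\<Sum>i\<in>T. norm (x $ i) - norm ((z - x) $ i)) \<le> (\<Sum>i\<in>T. norm (z $ i))"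
    by (intro sum_mono)
      (use norm_triangle_ineq2[of "x $ i" "x $ i - z $ i" for i] in \<open>simp add: norm_minus_commute\<close>)
  moreover have "(\<Sum>i\<in>-T. norm ((z - x) $ i) - norm (x $ i)) \<le> (\<Sum>i\<in>-T. norm (z $ i))"
    by (intro sum_mono)
      (use norm_triangle_ineq4[of "z $ i" "x $ i" for i] in \<open>simp add: algebra_simps\<close>)
  ultimately show ?thesis
    using assms unfolding split sum_subtractf by simp
qed

theorem theorem4p1:
  fixes \<Phi> :: "real ^ 'n ^ 'm" and s :: nat and \<delta> \<eta> :: real
    and x xs x_sharp :: "quat ^ 'n" and y e :: "quat ^ 'm"
  assumes "s \<ge> 1"
    and "rip (2 * s) \<delta> \<Phi>"
    and "\<delta> < 1 / 3"
    and "\<eta> \<ge> 0"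
    and "y = qmult_vec \<Phi> x + e"
    and "lp_norm 2 e \<le> \<eta>"
    and "is_arg_min (lp_norm 1) (\<lambda>z. lp_norm 2 (qmult_vec \<Phi> z - y) \<le> \<eta>) x_sharp"
    and "best_sparse_approx s x xs"
  shows "lp_norm 2 (x_sharp - x)
    \<le> (2 * (1 + \<delta>) / (1 - 3 * \<delta>)) / sqrt (real s) * lp_norm 1 (x - xs)
      + (4 * sqrt (1 + \<delta>) / (1 - 3 * \<delta>)) * \<eta>"
proof -
  obtain T where T: "card T = min s CARD('n)" and xs: "xs = restrict_vec x T"
    using assms(8) by (auto simp: best_sparse_approx_def restrict_vec_def)
  have "(\<Sum>i\<in>UNIV. norm ((x - xs) $ i)) = (\<Sum>i\<in>UNIV. if i \<in> - T then norm (x $ i) else 0)"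
    unfolding xs by (intro sum.cong) auto
  then have sigma: "lp_norm 1 (x - xs) = (\<Sum>i\<in>-T. norm (x $ i))"
    unfolding lp_norm_1 by (simp add: sum.If_cases Compl_eq)
  \<comment> \<open>The residual of \<open>x\<close> has norm at most \<eta>, so \<open>x\<close> is
    feasible and competes with the minimizer.\<close>
  have res: "qmult_vec \<Phi> x - y = - e"
    using assms(5) by simp
  have feas: "norm (qmult_vec \<Phi> x_sharp - y) \<le> \<eta>"
    and min: "\<not> lp_norm 1 x < lp_norm 1 x_sharp"
    using assms(6,7) res by (auto simp: is_arg_min_def lp_norm_2)
  have "qmult_vec \<Phi> (x_sharp - x) = (qmult_vec \<Phi> x_sharp - y) + e"
    by (simp add: linear_diff[OF linear_qmult_vec] assms(5))
  then have "norm (qmult_vec \<Phi> (x_sharp - x)) \<le> 2 * \<eta>"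
    using norm_triangle_ineq[of "qmult_vec \<Phi> x_sharp - y" e] feas assms(6)
    by (simp add: lp_norm_2)
  moreover have "(\<Sum>i\<in>-T. norm ((x_sharp - x) $ i))
    \<le> (\<Sum>i\<in>T. norm ((x_sharp - x) $ i)) + 2 * (\<Sum>i\<in>-T. norm (x $ i))"
    using min by (intro l1_minimizer_cone) (simp add: lp_norm_1)
  moreover have "0 \<le> \<delta>"
    using assms(2) by (simp add: rip_def)
  ultimately show ?thesis
    unfolding lp_norm_2 sigma using T
    by (intro rip_error_bound[OF assms(1) linear_qmult_vec _ assms(3) rip_qmult_vec[OF assms(2)]]) auto
qed

end
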